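(* Let $\mathcal{H}$ be a separable complex Hilbert space and let $P\in\mathcal{B}(\mathcal{H})$ be a bounded idempotent ($P^2=P$, not necessarily self-adjoint). Suppose $P$ and $I-P$ have respectively the operator matrices $$P=\begin{pmatrix}I&P_{1}\\0&0\end{pmatrix}\ \text{on } R(P)\oplus R(P)^{\perp},\qquad I-P=\begin{pmatrix}I&Q_{1}\\0&0\end{pmatrix}\ \text{on } R(I-P)\oplus R(I-P)^{\perp},$$ where $P_1\in\mathcal{B}(R(P)^{\perp},R(P))$ and $Q_1\in\mathcal{B}(R(I-P)^{\perp},R(I-P))$. Then: (i) $P_{(2I-P-P^{\ast})^{+}}=P_{(P+P^{\ast})^{-}}+P_{N(P+P^* )}$; (ii) $P_{N(P_{1}^{\ast})}=P_{N(Q_{1})}$ and $P_{N(P_{1})}=P_{N(Q_{1}^{\ast})}$; (iii) $P_{(2I-P-P^{\ast})^{-}}+P_{N(2I-P-P^{\ast})}=P_{(P+P^{\ast})^{+}}$.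
   Context: $N(T)$ and $R(T)$ denote the null space and range of $T$. For a closed subspace $\mathcal{M}$ of $\mathcal{H}$, $P_{\mathcal{M}}$ is the orthogonal projection of $\mathcal{H}$ onto $\mathcal{M}$; for an operator $A$ on $\mathcal{H}$, $P_A$ is the orthogonal projection onto $\overline{R(A)}$. For self-adjoint $A$, $A^{+}=\frac{|A|+A}{2}$ and $A^{-}=\frac{|A|-A}{2}$. In (ii), the null spaces $N(P_1^{\ast})\subseteq R(P)$, $N(P_1)\subseteq R(P)^{\perp}$, $N(Q_1)\subseteq R(I-P)^{\perp}$, $N(Q_1^{\ast})\subseteq R(I-P)$ are regarded as closed subspaces of $\mathcal{H}$, and the identities are between orthogonal projections in $\mathcal{B}(\mathcal{H})$. Every bounded idempotent $P$ has a (unique) matrix of the stated form with respect to $R(P)\oplus R(P)^{\perp}$, and likewise for $I-P$. *)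

theory Defs
  imports "HOL-Analysis.Analysis"
begin

(* A complex Hilbert space is a complete real inner product space carrying a compatible complex
   scalar multiplication and a sesquilinear form (linear in the first argument) whose real part
   is the given real inner product; so norm x ^ 2 = Re (cinner x x) = cinner x x. *)
class complex_hilbert = real_inner + complete_space +
  fixes scaleC :: "complex \<Rightarrow> 'a \<Rightarrow> 'a" (infixr "*\<^sub>C" 75)
    and cinner :: "'a \<Rightarrow> 'a \<Rightarrow> complex"
  assumes scaleC_add_right: "c *\<^sub>C (x + y) = c *\<^sub>C x + c *\<^sub>C y"
    and scaleC_add_left: "(c + d) *\<^sub>C x = c *\<^sub>C x + d *\<^sub>C x"
    and scaleC_scaleC: "c *\<^sub>C (d *\<^sub>C x) = (c * d) *\<^sub>C x"
    and scaleC_of_real: "complex_of_real r *\<^sub>C x = r *\<^sub>R x"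
    and cinner_commute: "cinner x y = cnj (cinner y x)"
    and cinner_add_left: "cinner (x + y) z = cinner x z + cinner y z"
    and cinner_scaleC_left: "cinner (c *\<^sub>C x) y = c * cinner x y"
    and inner_eq_Re_cinner: "inner x y = Re (cinner x y)"

instantiation complex :: complex_hilbert
begin

definition scaleC_complex_def: "scaleC c (x::complex) = c * x"

definition cinner_complex_def: "cinner (x::complex) y = x * cnj y"

instance
  by standard
    (auto simp: scaleC_complex_def cinner_complex_def algebra_simps scaleR_conv_of_real
      inner_complex_def)

end

definition orth_compl :: "'a::complex_hilbert set \<Rightarrow> 'a set" where
  "orth_compl M = {x. \<forall>y\<in>M. cinner x y = 0}"

(* The type of bounded linear maps only provides real-linear maps; B(H) consists of those
   satisfying this predicate. *)
definition complex_linear :: "('a::complex_hilbert \<Rightarrow>\<^sub>L 'a) \<Rightarrow> bool" where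
  "complex_linear T \<longleftrightarrow> (\<forall>c x. T (c *\<^sub>C x) = c *\<^sub>C T x)"

definition adj :: "('a::complex_hilbert \<Rightarrow>\<^sub>L 'a) \<Rightarrow> ('a \<Rightarrow>\<^sub>L 'a)" where
  "adj T = (THE S :: 'a \<Rightarrow>\<^sub>L 'a. \<forall>x y. cinner (T x) y = cinner x (S y))"

definition null_space :: "('a::complex_hilbert \<Rightarrow>\<^sub>L 'a) \<Rightarrow> 'a set" where
  "null_space T = {x. T x = 0}"

(* Meaningful for closed complex subspaces M. *)
definition proj :: "'a::complex_hilbert set \<Rightarrow> ('a \<Rightarrow>\<^sub>L 'a)" where
  "proj M = (THE Q :: 'a \<Rightarrow>\<^sub>L 'a. \<forall>x. Q x \<in> M \<and> x - Q x \<in> orth_compl M)"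

definition range_proj :: "('a::complex_hilbert \<Rightarrow>\<^sub>L 'a) \<Rightarrow> ('a \<Rightarrow>\<^sub>L 'a)" where
  "range_proj T = proj (closure (range T))"

definition positive_op :: "('a::complex_hilbert \<Rightarrow>\<^sub>L 'a) \<Rightarrow> bool" where
  "positive_op T \<longleftrightarrow> complex_linear T \<and> (\<forall>x. cinner (T x) x \<in> \<real>\<^sub>\<ge>\<^sub>0)"

(* |T|, the unique positive square root of T* T. *)
definition abs_op :: "('a::complex_hilbert \<Rightarrow>\<^sub>L 'a) \<Rightarrow> ('a \<Rightarrow>\<^sub>L 'a)" where
  "abs_op T = (THE S. positive_op S \<and> S o\<^sub>L S = adj T o\<^sub>L T)"

definition pos_part :: "('a::complex_hilbert \<Rightarrow>\<^sub>L 'a) \<Rightarrow> ('a \<Rightarrow>\<^sub>L 'a)" where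
  "pos_part A = (abs_op A + A) /\<^sub>R 2"

definition neg_part :: "('a::complex_hilbert \<Rightarrow>\<^sub>L 'a) \<Rightarrow> ('a \<Rightarrow>\<^sub>L 'a)" where
  "neg_part A = (abs_op A - A) /\<^sub>R 2"

(* Operators between closed subspaces M and N of the ambient space are represented by functions
   on the whole space of which only the values on M matter. *)
definition bounded_op_between ::
    "'a::complex_hilbert set \<Rightarrow> 'a set \<Rightarrow> ('a \<Rightarrow> 'a) \<Rightarrow> bool" where
  "bounded_op_between M N T \<longleftrightarrow>
     (\<forall>x\<in>M. T x \<in> N) \<and>
     (\<forall>x\<in>M. \<forall>y\<in>M. T (x + y) = T x + T y) \<and>
     (\<forall>c. \<forall>x\<in>M. T (c *\<^sub>C x) = c *\<^sub>C T x) \<and>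
     (\<exists>K. \<forall>x\<in>M. norm (T x) \<le> K * norm x)"

(* For T from M to N, the values of the adjoint (from N to M) at points of N; T is only
   evaluated on M. *)
definition adj_on :: "'a::complex_hilbert set \<Rightarrow> ('a \<Rightarrow> 'a) \<Rightarrow> ('a \<Rightarrow> 'a)" where
  "adj_on M T y = (THE z. z \<in> M \<and> (\<forall>x\<in>M. cinner (T x) y = cinner x z))"

definition null_space_on :: "'a::complex_hilbert set \<Rightarrow> ('a \<Rightarrow> 'a) \<Rightarrow> 'a set" where
  "null_space_on M T = {x\<in>M. T x = 0}"

(* T has the operator matrix (A, B; C, D) with respect to the orthogonal decomposition of the
   space into the closed subspace M and its orthogonal complement. *)
definition has_op_matrix ::
    "('a::complex_hilbert \<Rightarrow>\<^sub>L 'a) \<Rightarrow> 'a set \<Rightarrow>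
      ('a \<Rightarrow> 'a) \<Rightarrow> ('a \<Rightarrow> 'a) \<Rightarrow> ('a \<Rightarrow> 'a) \<Rightarrow> ('a \<Rightarrow> 'a) \<Rightarrow> bool" where
  "has_op_matrix T M A B C D \<longleftrightarrow>
     bounded_op_between M M A \<and> bounded_op_between (orth_compl M) M B \<and>
     bounded_op_between M (orth_compl M) C \<and>
     bounded_op_between (orth_compl M) (orth_compl M) D \<and>
     (\<forall>u\<in>M. \<forall>v\<in>orth_compl M. T (u + v) = (A u + B v) + (C u + D v))"

end

theory Submission
  imports Defs
begin

text \<open>
  Put \<open>J = P + P\<^sup>* - I\<close> and \<open>D = P - P\<^sup>*\<close>. Idempotency gives
  \<open>J\<^sup>2 = I + D\<^sup>* D \<ge> I\<close>, so \<open>P + P\<^sup>* = J + I\<close> has no spectrum in \<open>(0, 2)\<close>.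
  Concretely, let \<open>S\<close> be the positive square root of \<open>J\<^sup>2\<close> and \<open>V = J S\<^sup>-\<^sup>1\<close>
  the sign of \<open>J\<close>; then \<open>S \<ge> I\<close> and \<open>V\<close> is a self-adjoint involution commuting with
  \<open>S\<close>. Since \<open>-I \<le> V \<le> I \<le> S\<close>, uniqueness of positive square roots yields
  \<open>\<bar>J + I\<bar> = S + V\<close> and \<open>\<bar>I - J\<bar> = S - V\<close>. With the spectral projection
  \<open>E = (I + V)/2\<close> this reads \<open>(P + P\<^sup>*)\<^sup>- = (S - I)(I - E)\<close> and
  \<open>(2I - P - P\<^sup>*)\<^sup>+ = (S + I)(I - E)\<close>, from which the null spaces, hence the closures of
  the ranges, can be read off. This gives (i), and (iii) is (i) for the idempotent \<open>I - P\<close>.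
  In (ii), the null spaces of \<open>P\<^sub>1\<^sup>*\<close> and \<open>Q\<^sub>1\<close> both equal the part of \<open>R(P)\<close>
  orthogonal to \<open>R(I - P)\<close>.

  Apart from complex linearity everything takes place in the underlying real Hilbert space:
  an operator is complex linear iff it commutes with multiplication by \<open>\<i>\<close>, so this property
  passes to square roots, which commute with everything that commutes with the given operator.
\<close>

subsection \<open>Orthogonal projections and adjoints\<close>

text \<open>A sequence in \<open>M\<close> minimizing the distance to \<open>x\<close> is Cauchy by
  the parallelogram law. Its limit attains the distance, and varying it along \<open>m\<close>
  yields orthogonality.\<close>

lemma subspace_orthogonal_decomposition:
  fixes M :: "'a::{real_inner,complete_space} set"
  assumes M: "subspace M" "closed M"
  shows "\<exists>y\<in>M. \<forall>m\<in>M. (x - y) \<bullet> m = 0"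
proof -
  define d where "d = (INF y\<in>M. (norm (x - y))\<^sup>2)"
  have bdd: "bdd_below ((\<lambda>y. (norm (x - y))\<^sup>2) ` M)"
    by (rule bdd_belowI[of _ 0]) auto
  have ne: "M \<noteq> {}"
    using subspace_0[OF M(1)] by auto
  have d_le: "d \<le> (norm (x - y))\<^sup>2" if "y \<in> M" for y
    unfolding d_def using bdd that by (rule cINF_lower)
  have "\<exists>y\<in>M. (norm (x - y))\<^sup>2 < d + 1 / real (Suc n)" for n
    using cINF_less_iff[OF ne bdd, of "d + 1 / real (Suc n)"] by (simp add: d_def[symmetric])
  then obtain Y where YM: "Y n \<in> M" and Yd: "(norm (x - Y n))\<^sup>2 < d + 1 / real (Suc n)" for n
    by metis
  have diff: "(norm (Y m - Y n))\<^sup>2 \<le> 2 * (1 / real (Suc m)) + 2 * (1 / real (Suc n))" for m n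
  proof -
    \<comment> \<open>The midpoint competes in the infimum, which bounds the norm of (x - Y m) + (x
      - Y n) from below.\<close>
    have "(1/2) *\<^sub>R (Y m + Y n) \<in> M"
      using M(1) YM by (simp add: subspace_add subspace_scale)
    from d_le[OF this]
    have "4 * d \<le> (norm ((x - Y m) + (x - Y n)))\<^sup>2"
      by (simp add: power2_norm_eq_inner inner_simps inner_commute algebra_simps)
    also have "\<dots> = 2 * (norm (x - Y m))\<^sup>2 + 2 * (norm (x - Y n))\<^sup>2 - (norm (Y m - Y n))\<^sup>2"
      by (simp add: power2_norm_eq_inner inner_simps inner_commute algebra_simps)
    finally show ?thesis
      using Yd[of m] Yd[of n] by linarith
  qed
  have "Cauchy Y"
  proof (rule CauchyI)
    fix e :: real assume "0 < e"
    then have "0 < e\<^sup>2 / 4" by simp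
    then obtain N where N: "inverse (real (Suc N)) < e\<^sup>2 / 4"
      using reals_Archimedean by blast
    have "norm (Y m - Y n) < e" if "m \<ge> N" "n \<ge> N" for m n
    proof -
      have "1 / real (Suc m) \<le> inverse (real (Suc N))" "1 / real (Suc n) \<le> inverse (real (Suc N))"
        using that by (simp_all add: field_simps)
      then have "(norm (Y m - Y n))\<^sup>2 < e\<^sup>2"
        using diff[of m n] N by linarith
      then show ?thesis
        using \<open>0 < e\<close> power_less_imp_less_base by fastforce
    qed
    then show "\<exists>N. \<forall>m\<ge>N. \<forall>n\<ge>N. norm (Y m - Y n) < e" by blast
  qed
  then obtain y where lim: "Y \<longlonglongrightarrow> y"
    using Cauchy_convergent_iff convergent_def by blast
  have yM: "y \<in> M"
    using M(2) YM lim by (rule closed_sequentially)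
  have "(\<lambda>n. (norm (x - Y n))\<^sup>2) \<longlonglongrightarrow> (norm (x - y))\<^sup>2"
    by (intro tendsto_intros lim)
  moreover have "(\<lambda>n. d + 1 / real (Suc n)) \<longlonglongrightarrow> d + 0"
    by (intro tendsto_intros LIMSEQ_Suc[OF lim_1_over_n])
  ultimately have yd: "(norm (x - y))\<^sup>2 \<le> d"
    using Yd by (intro LIMSEQ_le) (auto intro: less_imp_le)
  have "(x - y) \<bullet> m = 0" if m: "m \<in> M" for m
  proof (cases "m = 0")
    case False
    \<comment> \<open>This \<open>t\<close> minimizes the distance from \<open>x - y\<close> to the
      line spanned by \<open>m\<close>.\<close>
    define t where "t = ((x - y) \<bullet> m) / (m \<bullet> m)"
    have mm: "m \<bullet> m > 0" using False by simp
    have "y + t *\<^sub>R m \<in> M"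
      using M(1) yM m by (simp add: subspace_add subspace_scale)
    from order_trans[OF yd d_le[OF this]]
    have "0 \<le> t * t * (m \<bullet> m) - 2 * t * ((x - y) \<bullet> m)"
      by (simp add: power2_norm_eq_inner inner_simps inner_commute algebra_simps)
    also have "\<dots> = - (((x - y) \<bullet> m)\<^sup>2 / (m \<bullet> m))"
      using mm by (simp add: t_def field_simps power2_eq_square)
    finally have "((x - y) \<bullet> m)\<^sup>2 / (m \<bullet> m) \<le> 0" by linarith
    with mm show ?thesis by (metis divide_le_0_iff power2_less_eq_zero_iff not_le)
  qed simp
  with yM show ?thesis by blast
qed

text \<open>The representing vector is a multiple of some \<open>w\<close> orthogonal to the kernel
  of \<open>f\<close>; it exists because the kernel is closed.\<close>

lemma riesz_representation:
  fixes f :: "'a::{real_inner,complete_space} \<Rightarrow> real"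
  assumes f: "bounded_linear f"
  shows "\<exists>z. \<forall>x. f x = x \<bullet> z"
proof (cases "\<forall>x. f x = 0")
  case True
  then show ?thesis by (intro exI[of _ 0]) simp
next
  case False
  interpret f: bounded_linear f by (rule f)
  obtain u where u: "f u \<noteq> 0" using False by blast
  let ?K = "{x. f x = 0}"
  have "subspace ?K"
    by (auto simp: subspace_def f.zero f.add f.scale)
  moreover have "closed ?K"
    by (intro closed_Collect_eq continuous_intros f.continuous_on)
  ultimately obtain v where v: "f v = 0" "\<And>m. f m = 0 \<Longrightarrow> (u - v) \<bullet> m = 0"
    using subspace_orthogonal_decomposition[of ?K u] by auto
  define w where "w = u - v"
  have fw: "f w \<noteq> 0" using u v(1) by (simp add: w_def f.diff)
  then have ww: "w \<bullet> w \<noteq> 0" using f.zero by auto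
  have "f x = x \<bullet> ((f w / (w \<bullet> w)) *\<^sub>R w)" for x
  proof -
    \<comment> \<open>This combination of \<open>x\<close> and \<open>w\<close> lies in the kernel,
      hence is orthogonal to \<open>w\<close>; solving for \<open>f x\<close> gives the
      formula.\<close>
    have "f (f w *\<^sub>R x - f x *\<^sub>R w) = 0" by (simp add: f.diff f.scale)
    then have "w \<bullet> (f w *\<^sub>R x - f x *\<^sub>R w) = 0" using v(2) w_def by blast
    then show ?thesis using ww by (simp add: inner_simps inner_commute field_simps)
  qed
  then show ?thesis by blast
qed

subclass (in complex_hilbert) banach ..

text \<open>Riesz representation of the functional sending \<open>x\<close> to the inner product of
  \<open>T x\<close> and \<open>y\<close>. Linearity in \<open>y\<close> follows from uniqueness of
  the representing vector.\<close>

lemma blinfun_adjoint_exists: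
  fixes T :: "'a::{real_inner,banach} \<Rightarrow>\<^sub>L 'a"
  shows "\<exists>S :: 'a \<Rightarrow>\<^sub>L 'a. \<forall>x y. T x \<bullet> y = x \<bullet> S y"
proof -
  have "\<exists>z. \<forall>x. T x \<bullet> y = x \<bullet> z" for y
    by (rule riesz_representation)
      (intro bounded_linear_compose[OF bounded_linear_inner_left] blinfun.bounded_linear_right)
  then obtain s where s: "T x \<bullet> y = x \<bullet> s y" for x y by metis
  have "bounded_linear s"
  proof (rule bounded_linear_intro)
    show "s (x + y) = s x + s y" for x y
      by (rule vector_eq_ldot[THEN iffD1]) (simp add: inner_right_distrib flip: s)
    show "s (r *\<^sub>R x) = r *\<^sub>R s x" for r x
      by (rule vector_eq_ldot[THEN iffD1]) (simp flip: s)
    show "norm (s y) \<le> norm y * norm T" for y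
    proof -
      have "norm (s y) * norm (s y) = T (s y) \<bullet> y"
        by (simp add: s flip: power2_norm_eq_inner power2_eq_square)
      also have "\<dots> \<le> norm (T (s y)) * norm y"
        by (rule norm_cauchy_schwarz)
      also have "\<dots> \<le> norm T * norm (s y) * norm y"
        by (intro mult_right_mono norm_blinfun) simp
      finally have "norm (s y) * norm (s y) \<le> norm (s y) * (norm y * norm T)"
        by (simp add: algebra_simps)
      then show ?thesis
        by (cases "norm (s y) = 0") (auto simp: mult_le_cancel_left)
    qed
  qed
  then show ?thesis
    using s by (intro exI[of _ "Blinfun s"]) (simp add: bounded_linear_Blinfun_apply)
qed

text \<open>Uniqueness of the orthogonal decomposition makes it linear in \<open>x\<close>;
  Pythagoras gives norm at most 1.\<close>

lemma blinfun_orthogonal_projection_exists: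
  fixes M :: "'a::{real_inner,banach} set"
  assumes M: "subspace M" "closed M"
  shows "\<exists>Q :: 'a \<Rightarrow>\<^sub>L 'a. \<forall>x. Q x \<in> M \<and> (\<forall>m\<in>M. (x - Q x) \<bullet> m = 0)"
proof -
  from subspace_orthogonal_decomposition[OF M]
  obtain q where q: "q x \<in> M" "m \<in> M \<Longrightarrow> (x - q x) \<bullet> m = 0" for x m by metis
  have eq: "q x = y" if "y \<in> M" "\<And>m. m \<in> M \<Longrightarrow> (x - y) \<bullet> m = 0" for x y
  proof -
    have m: "q x - y \<in> M" using M(1) q(1) that(1) by (rule subspace_diff)
    have "(q x - y) \<bullet> (q x - y) = (x - y) \<bullet> (q x - y) - (x - q x) \<bullet> (q x - y)"
      by (simp add: inner_simps)
    also have "\<dots> = 0" using m that(2) q(2) by simp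
    finally show ?thesis by simp
  qed
  have "bounded_linear q"
  proof (rule bounded_linear_intro[where K = 1])
    show "q (x + y) = q x + q y" for x y
    proof (rule eq)
      show "(x + y - (q x + q y)) \<bullet> m = 0" if "m \<in> M" for m
        using q(2)[OF that, of x] q(2)[OF that, of y] by (simp add: inner_simps)
    qed (intro subspace_add M q)
    show "q (r *\<^sub>R x) = r *\<^sub>R q x" for r x
    proof (rule eq)
      show "(r *\<^sub>R x - r *\<^sub>R q x) \<bullet> m = 0" if "m \<in> M" for m
        using q(2)[OF that, of x] by (simp flip: scaleR_diff_right)
    qed (intro subspace_scale M q)
    show "norm (q x) \<le> norm x * 1" for x
    proof -
      have "(norm x)\<^sup>2 = (norm (q x))\<^sup>2 + (norm (x - q x))\<^sup>2"
        using q(2)[OF q(1), of x x]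
        by (simp add: power2_norm_eq_inner inner_simps inner_commute)
      then have "(norm (q x))\<^sup>2 \<le> (norm x)\<^sup>2" by simp
      then show ?thesis by (simp add: power2_le_iff_abs_le)
    qed
  qed
  then show ?thesis
    using q by (intro exI[of _ "Blinfun q"]) (simp add: bounded_linear_Blinfun_apply)
qed

subsection \<open>Positive square roots\<close>

text \<open>Uses the real inner product, so that square roots can be built without complex
  structure. For complex linear operators, \<open>adj_self_adj\<close> supplies the link to
  \<open>adj\<close>.\<close>

definition self_adj :: "('a::real_inner \<Rightarrow>\<^sub>L 'a) \<Rightarrow> bool" where
  "self_adj T \<longleftrightarrow> (\<forall>x y. T x \<bullet> y = x \<bullet> T y)"

lemma self_adjD: "self_adj T \<Longrightarrow> T x \<bullet> y = x \<bullet> T y"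
  by (simp add: self_adj_def)

lemma self_adj_add: "self_adj S \<Longrightarrow> self_adj T \<Longrightarrow> self_adj (S + T)"
  and self_adj_diff: "self_adj S \<Longrightarrow> self_adj T \<Longrightarrow> self_adj (S - T)"
  and self_adj_scaleR: "self_adj T \<Longrightarrow> self_adj (r *\<^sub>R T)"
  and self_adj_id: "self_adj id_blinfun"
  by (simp_all add: self_adj_def blinfun.bilinear_simps inner_simps)

lemma self_adj_compose:
  "self_adj S \<Longrightarrow> self_adj T \<Longrightarrow> S o\<^sub>L T = T o\<^sub>L S \<Longrightarrow> self_adj (S o\<^sub>L T)"
  unfolding self_adj_def by (metis blinfun_apply_blinfun_compose)

lemma closed_self_adj: "closed {T :: 'a::real_inner \<Rightarrow>\<^sub>L 'a. self_adj T}"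
  unfolding self_adj_def
  by (intro closed_Collect_all closed_Collect_eq continuous_intros)

lemma norm_blinfun_inner_le: "\<bar>(T :: 'a::real_inner \<Rightarrow>\<^sub>L 'a) x \<bullet> x\<bar> \<le> norm T * (x \<bullet> x)"
proof -
  have "\<bar>T x \<bullet> x\<bar> \<le> norm (T x) * norm x"
    by (rule Cauchy_Schwarz_ineq2)
  also have "\<dots> \<le> norm T * norm x * norm x"
    by (intro mult_right_mono norm_blinfun) simp
  finally show ?thesis
    by (simp add: mult.assoc power2_norm_eq_inner flip: power2_eq_square)
qed

text \<open>If 0 \<le> T \<le> m then T^2 \<le> m T: expand the nonnegative form of T at (m - T) x
  and bound its cubic term by m T^2.\<close>

lemma positive_inner_square_le:
  fixes T :: "'a::real_inner \<Rightarrow>\<^sub>L 'a"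
  assumes T: "self_adj T" "\<And>x. 0 \<le> T x \<bullet> x" "\<And>x. T x \<bullet> x \<le> m * (x \<bullet> x)" and m: "0 < m"
  shows "T x \<bullet> T x \<le> m * (T x \<bullet> x)"
proof -
  let ?y = "m *\<^sub>R x - T x"
  have "0 \<le> T ?y \<bullet> ?y" by (rule T)
  also have "\<dots> = m * m * (T x \<bullet> x) - 2 * m * (T x \<bullet> T x) + T (T x) \<bullet> T x"
    using self_adjD[OF T(1), of "T x" x]
    by (simp add: blinfun.bilinear_simps inner_simps algebra_simps)
  also have "T (T x) \<bullet> T x \<le> m * (T x \<bullet> T x)" by (rule T)
  finally have "m * (T x \<bullet> T x) \<le> m * (m * (T x \<bullet> x))"
    by (simp add: algebra_simps)
  then show ?thesis using m by simp
qed

lemma positive_zero_form_imp_zero: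
  fixes T :: "'a::real_inner \<Rightarrow>\<^sub>L 'a"
  assumes T: "self_adj T" "\<And>x. 0 \<le> T x \<bullet> x" and "T x \<bullet> x = 0"
  shows "T x = 0"
proof -
  \<comment> \<open>The added 1 keeps the bound strictly positive even for
    \<open>T = 0\<close>.\<close>
  have "T y \<bullet> y \<le> (norm T + 1) * (y \<bullet> y)" for y
    using norm_blinfun_inner_le[of T y] inner_ge_zero[of y] unfolding distrib_right by linarith
  from positive_inner_square_le[OF T this, of x] assms(3)
  have "T x \<bullet> T x \<le> 0" by (simp add: add_nonneg_pos)
  then show ?thesis by (metis inner_eq_zero_iff inner_ge_zero order_antisym)
qed

lemma positive_norm_le:
  fixes T :: "'a::real_inner \<Rightarrow>\<^sub>L 'a"
  assumes T: "self_adj T" "\<And>x. 0 \<le> T x \<bullet> x" "\<And>x. T x \<bullet> x \<le> m * (x \<bullet> x)" and m: "0 < m"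
  shows "norm T \<le> m"
proof (rule norm_blinfun_bound)
  fix x
  have "(norm (T x))\<^sup>2 \<le> m * (T x \<bullet> x)"
    using positive_inner_square_le[OF T m] by (simp add: power2_norm_eq_inner)
  also have "\<dots> \<le> m * (m * (x \<bullet> x))"
    using T(3) m by (intro mult_left_mono) auto
  also have "\<dots> = (m * norm x)\<^sup>2"
    by (simp add: power2_norm_eq_inner[symmetric] power2_eq_square algebra_simps)
  finally show "norm (T x) \<le> m * norm x"
    using m by (simp add: power2_le_iff_abs_le)
qed (use m in simp)

lemma closed_commuting: "closed {T. C o\<^sub>L T = T o\<^sub>L C}"
  for C :: "'a::real_normed_vector \<Rightarrow>\<^sub>L 'a"
  by (intro closed_Collect_eq continuous_intros)

text \<open>\<open>(I - Y)\<^sup>2 = I - K\<close> says that \<open>Y\<close> is a fixed point of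
  \<open>Y \<mapsto> (K + Y\<^sup>2)/2\<close>, a contraction of the ball of radius \<open>r = 1 - sqrt (1 - k)\<close>, since
  \<open>(k + r\<^sup>2)/2 = r\<close>.\<close>

lemma contraction_sqrt:
  fixes K :: "'a::{real_inner,banach} \<Rightarrow>\<^sub>L 'a"
  assumes K: "self_adj K" and k: "norm K \<le> k" "k < 1"
  obtains Y where "self_adj Y" "norm Y < 1"
    "(id_blinfun - Y) o\<^sub>L (id_blinfun - Y) = id_blinfun - K"
    "\<And>C. C o\<^sub>L K = K o\<^sub>L C \<Longrightarrow> C o\<^sub>L Y = Y o\<^sub>L C"
proof -
  define r where "r = 1 - sqrt (1 - k)"
  have k0: "0 \<le> k" using k(1) norm_ge_zero order_trans by blast
  have r: "0 \<le> r" "r < 1" using k0 k by (auto simp: r_def)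
  have rk: "k + r * r = 2 * r"
    using k by (simp add: r_def algebra_simps)
  \<comment> \<open>Self-adjointness and commutation are closed conditions preserved by
    \<open>f\<close>. Building them into the complete set lets the fixed point inherit them.\<close>
  define Ys where "Ys = cball 0 r \<inter> {Y. self_adj Y} \<inter> (\<Inter>C\<in>{C. C o\<^sub>L K = K o\<^sub>L C}. {Y. C o\<^sub>L Y = Y o\<^sub>L C})"
  define f where "f Y = (1/2) *\<^sub>R (K + (Y o\<^sub>L Y))" for Y :: "'a \<Rightarrow>\<^sub>L 'a"
  have "\<exists>!Y\<in>Ys. f Y = Y"
  proof (rule Banach_fix[where c = r])
    show "complete Ys"
      unfolding complete_eq_closed Ys_def
      by (intro closed_Int closed_cball closed_self_adj closed_INT ballI closed_commuting)
    have "0 \<in> Ys" using r by (auto simp: Ys_def self_adj_def)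
    then show "Ys \<noteq> {}" by blast
    show "f ` Ys \<subseteq> Ys"
    proof (rule image_subsetI)
      fix Y assume Y: "Y \<in> Ys"
      then have nY: "norm Y \<le> r" and sY: "self_adj Y" by (auto simp: Ys_def)
      have "norm (f Y) \<le> (1/2) * (k + r * r)"
        unfolding f_def norm_scaleR
        using norm_triangle_ineq[of K "Y o\<^sub>L Y"] norm_blinfun_compose[of Y Y] k
          mult_mono[OF nY nY r(1)] by auto
      then have "norm (f Y) \<le> r" using rk by simp
      moreover have "self_adj (f Y)"
        unfolding f_def using K sY by (intro self_adj_scaleR self_adj_add self_adj_compose) auto
      moreover have "C o\<^sub>L f Y = f Y o\<^sub>L C" if C: "C o\<^sub>L K = K o\<^sub>L C" for C
      proof -
        from C Y have CY: "C o\<^sub>L Y = Y o\<^sub>L C" by (auto simp: Ys_def)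
        have "C (K x) = K (C x)" "C (Y x) = Y (C x)" for x
          using C CY by (metis blinfun_apply_blinfun_compose)+
        then show ?thesis
          by (intro blinfun_eqI) (simp add: f_def blinfun.bilinear_simps)
      qed
      ultimately show "f Y \<in> Ys" by (auto simp: Ys_def)
    qed
    show "dist (f Y) (f Z) \<le> r * dist Y Z" if "Y \<in> Ys" "Z \<in> Ys" for Y Z
    proof -
      have n: "norm Y \<le> r" "norm Z \<le> r" using that by (auto simp: Ys_def)
      \<comment> \<open>This splitting of Y^2 - Z^2 does not require \<open>Y\<close> and
        \<open>Z\<close> to commute.\<close>
      have "f Y - f Z = (1/2) *\<^sub>R ((Y o\<^sub>L (Y - Z)) + ((Y - Z) o\<^sub>L Z))"
        by (intro blinfun_eqI) (simp add: f_def blinfun.bilinear_simps algebra_simps)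
      then have "norm (f Y - f Z) \<le> (1/2) * (norm (Y o\<^sub>L (Y - Z)) + norm ((Y - Z) o\<^sub>L Z))"
        by (simp add: norm_triangle_ineq)
      also have "\<dots> \<le> (1/2) * (r * norm (Y - Z) + norm (Y - Z) * r)"
        using n by (intro mult_left_mono add_mono order_trans[OF norm_blinfun_compose] mult_mono)
          (auto simp: r)
      finally show ?thesis by (simp add: dist_norm algebra_simps)
    qed
  qed (use r in auto)
  then obtain Y where Y: "Y \<in> Ys" "f Y = Y" by blast
  have "2 *\<^sub>R Y = K + (Y o\<^sub>L Y)"
    using arg_cong[OF Y(2), of "\<lambda>Y. 2 *\<^sub>R Y"] by (simp add: f_def)
  then have "2 *\<^sub>R Y x = K x + Y (Y x)" for x
    by (metis blinfun.add_left blinfun.scaleR_left blinfun_apply_blinfun_compose)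
  then have "(id_blinfun - Y) o\<^sub>L (id_blinfun - Y) = id_blinfun - K"
    by (intro blinfun_eqI) (simp add: blinfun.bilinear_simps algebra_simps scaleR_2)
  with Y(1) r(2) show thesis
    by (intro that[of Y]) (auto simp: Ys_def)
qed

text \<open>The fixed point of the contraction sending \<open>Z\<close> to I + Y Z is a right
  inverse; it is also a left inverse because I - Y is injective.\<close>

lemma contraction_inverse:
  fixes Y :: "'a::banach \<Rightarrow>\<^sub>L 'a"
  assumes Y: "norm Y < 1"
  obtains Z where "(id_blinfun - Y) o\<^sub>L Z = id_blinfun" "Z o\<^sub>L (id_blinfun - Y) = id_blinfun"
proof -
  have "\<exists>!Z::'a \<Rightarrow>\<^sub>L 'a. id_blinfun + (Y o\<^sub>L Z) = Z"
  proof (rule banach_fix_type[where c = "norm Y"])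
    show "\<forall>Z W. dist (id_blinfun + (Y o\<^sub>L Z)) (id_blinfun + (Y o\<^sub>L W)) \<le> norm Y * dist Z W"
      using norm_blinfun_compose[of Y]
      by (auto simp: dist_norm simp flip: bounded_bilinear.diff_right[OF bounded_bilinear_blinfun_compose])
  qed (use Y in auto)
  then obtain Z where "id_blinfun + (Y o\<^sub>L Z) = Z" by blast
  then have Z: "x + Y (Z x) = Z x" for x
    by (metis blinfun.add_left blinfun_apply_blinfun_compose blinfun_apply_id_blinfun id_apply)
  have inj: "x = 0" if "Y x = x" for x
  proof (rule ccontr)
    assume "x \<noteq> 0"
    then have "norm Y * norm x < 1 * norm x"
      using Y by (intro mult_strict_right_mono) auto
    with norm_blinfun[of Y x] that show False by simp
  qed
  show thesis
  proof
    show "(id_blinfun - Y) o\<^sub>L Z = id_blinfun"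
      using Z by (intro blinfun_eqI) (simp add: blinfun.bilinear_simps algebra_simps)
    \<comment> \<open>The fixed point equation at \<open>x - Y x\<close> shows that this vector is
      fixed by \<open>Y\<close>.\<close>
    have "Z (x - Y x) - x = 0" for x
      using Z[of "x - Y x"] by (intro inj) (simp add: blinfun.bilinear_simps algebra_simps)
    then show "Z o\<^sub>L (id_blinfun - Y) = id_blinfun"
      by (intro blinfun_eqI) (simp add: blinfun.bilinear_simps)
  qed
qed

text \<open>Rescaling writes G / c = I - K with norm K < 1, so \<open>contraction_sqrt\<close>
  applies. The lower bound \<open>\<delta>\<close> is what makes K a strict contraction and the root
  invertible.\<close>

lemma positive_sqrt_exists:
  fixes G :: "'a::{real_inner,banach} \<Rightarrow>\<^sub>L 'a"
  assumes G: "self_adj G" and \<delta>: "0 < \<delta>" "\<And>x. \<delta> * (x \<bullet> x) \<le> G x \<bullet> x"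
  obtains S R where "self_adj S" "\<And>x. 0 \<le> S x \<bullet> x" "S o\<^sub>L S = G"
    "S o\<^sub>L R = id_blinfun" "R o\<^sub>L S = id_blinfun"
    "\<And>C. C o\<^sub>L G = G o\<^sub>L C \<Longrightarrow> C o\<^sub>L S = S o\<^sub>L C"
proof -
  \<comment> \<open>c \<ge> norm G makes K positive; the summand 2 \<delta> makes c > \<delta>, so
    that k = 1 - \<delta> / c is positive.\<close>
  define c where "c = norm G + 2 * \<delta>"
  have c: "0 < c" "2 * \<delta> \<le> c" using \<delta> by (auto simp: c_def add_nonneg_pos)
  define K where "K = id_blinfun - (1/c) *\<^sub>R G"
  define k where "k = 1 - \<delta> / c"
  have k: "0 < k" "k < 1" using c \<delta> by (auto simp: k_def)
  have K: "self_adj K"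
    unfolding K_def by (intro self_adj_diff self_adj_id self_adj_scaleR G)
  have Kx: "K x \<bullet> x = x \<bullet> x - (G x \<bullet> x) / c" for x
    by (simp add: K_def blinfun.bilinear_simps inner_simps)
  have "norm K \<le> k"
  proof (rule positive_norm_le[OF K])
    fix x
    have "G x \<bullet> x \<le> norm G * (x \<bullet> x)"
      using norm_blinfun_inner_le[of G x] by simp
    also have "\<dots> \<le> c * (x \<bullet> x)"
      using \<delta>(1) by (intro mult_right_mono) (auto simp: c_def)
    finally show "0 \<le> K x \<bullet> x"
      using c by (simp add: Kx field_simps)
    show "K x \<bullet> x \<le> k * (x \<bullet> x)"
      using \<delta>(2)[of x] c by (simp add: Kx k_def field_simps)
  qed (rule k)
  from contraction_sqrt[OF K this k(2)] obtain Y where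
    Y: "self_adj Y" "norm Y < 1" "(id_blinfun - Y) o\<^sub>L (id_blinfun - Y) = id_blinfun - K"
      "\<And>C. C o\<^sub>L K = K o\<^sub>L C \<Longrightarrow> C o\<^sub>L Y = Y o\<^sub>L C"
    by blast
  from contraction_inverse[OF Y(2)] obtain Z where
    Z: "(id_blinfun - Y) o\<^sub>L Z = id_blinfun" "Z o\<^sub>L (id_blinfun - Y) = id_blinfun"
    by blast
  define S where "S = sqrt c *\<^sub>R (id_blinfun - Y)"
  define R where "R = (1 / sqrt c) *\<^sub>R Z"
  note comp_simps = bounded_bilinear.scaleR_left[OF bounded_bilinear_blinfun_compose]
    bounded_bilinear.scaleR_right[OF bounded_bilinear_blinfun_compose]
  show thesis
  proof
    show "self_adj S"
      unfolding S_def by (intro self_adj_scaleR self_adj_diff self_adj_id Y)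
    show "0 \<le> S x \<bullet> x" for x
    proof -
      have "Y x \<bullet> x \<le> norm Y * (x \<bullet> x)" using norm_blinfun_inner_le[of Y x] by simp
      also have "\<dots> \<le> 1 * (x \<bullet> x)" using Y(2) by (intro mult_right_mono) auto
      finally show ?thesis
        using c by (simp add: S_def blinfun.bilinear_simps inner_simps)
    qed
    show "S o\<^sub>L S = G"
      using c by (simp add: S_def comp_simps Y(3)) (simp add: K_def)
    show "S o\<^sub>L R = id_blinfun" "R o\<^sub>L S = id_blinfun"
      using c by (simp_all add: S_def R_def comp_simps Z)
    show "C o\<^sub>L S = S o\<^sub>L C" if "C o\<^sub>L G = G o\<^sub>L C" for C
    proof -
      have G: "C (G x) = G (C x)" for x
        using that by (metis blinfun_apply_blinfun_compose)
      have "C o\<^sub>L K = K o\<^sub>L C"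
        by (intro blinfun_eqI) (simp add: K_def blinfun.bilinear_simps G)
      from Y(4)[OF this] have "C (Y x) = Y (C x)" for x
        by (metis blinfun_apply_blinfun_compose)
      then show ?thesis
        by (intro blinfun_eqI) (simp add: S_def blinfun.bilinear_simps)
    qed
  qed
qed

text \<open>With \<open>D = S - T\<close> one has \<open>S D = - D T\<close> and \<open>D S = - T D\<close>, so \<open>S\<close> commutes with
  \<open>D\<^sup>2\<close> and \<open>S D\<^sup>2 = - D T D \<le> 0\<close>. On the other hand \<open>S (D\<^sup>2 + \<epsilon>) = W S W \<ge> 0\<close>
  for the square root \<open>W\<close> of \<open>D\<^sup>2 + \<epsilon>\<close>. Hence \<open>D T D = 0\<close>.\<close>

lemma positive_sqrt_unique_aux:
  fixes S T :: "'a::{real_inner,banach} \<Rightarrow>\<^sub>L 'a"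
  assumes S: "self_adj S" "\<And>x. 0 \<le> S x \<bullet> x" and T: "self_adj T" "\<And>x. 0 \<le> T x \<bullet> x"
    and eq: "\<And>x. S (S x) = T (T x)"
  shows "T (S x - T x) = 0"
proof -
  define D where "D = S - T"
  have D: "self_adj D" unfolding D_def by (intro self_adj_diff S T)
  have SD: "S (D x) = - D (T x)" and DS: "D (S x) = - T (D x)" for x
    using eq[of x] by (simp_all add: D_def blinfun.bilinear_simps)
  have comm: "S (D (D x)) = D (D (S x))" for x
    by (simp add: SD DS blinfun.bilinear_simps)
  have "0 \<le> S (D (D x)) \<bullet> x"
  proof (rule field_le_epsilon)
    fix e :: real assume e: "0 < e"
    \<comment> \<open>Chosen so that the error term \<epsilon> (S x \<bullet> x) stays below
      \<open>e\<close>; the 1 prevents division by zero. The shift by \<open>\<epsilon>\<close>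
      gives \<open>G\<close> the strict lower bound required for a square root.\<close>
    define \<epsilon> where "\<epsilon> = e / (S x \<bullet> x + 1)"
    have \<epsilon>: "0 < \<epsilon>" using e S(2)[of x] by (simp add: \<epsilon>_def add_nonneg_pos)
    define G where "G = (D o\<^sub>L D) + \<epsilon> *\<^sub>R id_blinfun"
    have G: "G y = D (D y) + \<epsilon> *\<^sub>R y" for y
      by (simp add: G_def blinfun.bilinear_simps)
    have "self_adj G"
      unfolding G_def by (intro self_adj_add self_adj_compose self_adj_scaleR self_adj_id D refl)
    moreover have "\<epsilon> * (y \<bullet> y) \<le> G y \<bullet> y" for y
      using self_adjD[OF D, of "D y" y] by (simp add: G inner_simps)
    ultimately obtain W where W: "self_adj W" "W o\<^sub>L W = G"
        "\<And>C. C o\<^sub>L G = G o\<^sub>L C \<Longrightarrow> C o\<^sub>L W = W o\<^sub>L C"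
      using positive_sqrt_exists[of G \<epsilon>] \<epsilon> by metis
    have "S o\<^sub>L G = G o\<^sub>L S"
      by (intro blinfun_eqI) (simp add: G blinfun.bilinear_simps comm)
    from W(3)[OF this] have SW: "S (W y) = W (S y)" for y
      by (metis blinfun_apply_blinfun_compose)
    have "0 \<le> S (W x) \<bullet> W x" by (rule S)
    also have "\<dots> = S (W (W x)) \<bullet> x" by (simp add: SW self_adjD[OF W(1)])
    also have "W (W x) = G x" using W(2) by (metis blinfun_apply_blinfun_compose)
    also have "S (G x) \<bullet> x = S (D (D x)) \<bullet> x + \<epsilon> * (S x \<bullet> x)"
      by (simp add: G blinfun.bilinear_simps inner_simps)
    also have "\<epsilon> * (S x \<bullet> x) \<le> e"
      using e S(2)[of x] by (simp add: \<epsilon>_def divide_simps algebra_simps)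
    finally show "0 \<le> S (D (D x)) \<bullet> x + e" by simp
  qed
  also have "S (D (D x)) \<bullet> x = - (T (D x) \<bullet> D x)"
    by (simp add: SD self_adjD[OF D])
  finally have "T (D x) \<bullet> D x = 0"
    using T(2)[of "D x"] by simp
  then have "T (D x) = 0"
    by (rule positive_zero_form_imp_zero[OF T])
  then show ?thesis by (simp add: D_def blinfun.bilinear_simps)
qed

text \<open>By symmetry both \<open>S\<close> and \<open>T\<close> annihilate D x, where D = S - T.
  Self-adjointness then turns the squared norm of D x into the inner product of \<open>x\<close>
  with S (D x) - T (D x), which is 0.\<close>

lemma positive_sqrt_unique:
  fixes S T :: "'a::{real_inner,banach} \<Rightarrow>\<^sub>L 'a"
  assumes S: "self_adj S" "\<And>x. 0 \<le> S x \<bullet> x" and T: "self_adj T" "\<And>x. 0 \<le> T x \<bullet> x"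
    and eq: "S o\<^sub>L S = T o\<^sub>L T"
  shows "S = T"
proof (rule blinfun_eqI)
  fix x
  have eq': "S (S y) = T (T y)" for y
    using eq by (metis blinfun_apply_blinfun_compose)
  have "T (S x - T x) = 0" "S (T x - S x) = 0"
    using positive_sqrt_unique_aux[OF S T eq'] positive_sqrt_unique_aux[OF T S eq'[symmetric]]
    by auto
  then have "(S x - T x) \<bullet> (S x - T x) = 0"
    using self_adjD[OF S(1), of x "S x - T x"] self_adjD[OF T(1), of x "S x - T x"]
    by (simp add: inner_diff_left blinfun.bilinear_simps)
  then show "S x = T x" by simp
qed

text \<open>The polar decomposition of \<open>J\<close>: S is the modulus and V = J R, with R the
  inverse of S, is the sign. Commutation with \<open>S\<close> and \<open>V\<close> is recorded to
  recover complex linearity later.\<close>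

lemma sign_decomposition:
  fixes J :: "'a::{real_inner,banach} \<Rightarrow>\<^sub>L 'a"
  assumes J: "self_adj J" and J1: "\<And>x. x \<bullet> x \<le> J x \<bullet> J x"
  obtains S V where "self_adj S" "\<And>x. x \<bullet> x \<le> S x \<bullet> x"
    "self_adj V" "V o\<^sub>L V = id_blinfun"
    "J o\<^sub>L V = S" "V o\<^sub>L J = S" "S o\<^sub>L V = J" "V o\<^sub>L S = J"
    "\<And>C. C o\<^sub>L J = J o\<^sub>L C \<Longrightarrow> C o\<^sub>L S = S o\<^sub>L C \<and> C o\<^sub>L V = V o\<^sub>L C"
proof -
  have "self_adj (J o\<^sub>L J)" by (intro self_adj_compose J refl)
  moreover have "1 * (x \<bullet> x) \<le> (J o\<^sub>L J) x \<bullet> x" for x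
    using J1[of x] self_adjD[OF J, of "J x" x] by simp
  ultimately obtain S R where S: "self_adj S" "\<And>x. 0 \<le> S x \<bullet> x" and SS: "S o\<^sub>L S = J o\<^sub>L J"
    and SR: "S o\<^sub>L R = id_blinfun" "R o\<^sub>L S = id_blinfun"
    and comm: "\<And>C. C o\<^sub>L (J o\<^sub>L J) = (J o\<^sub>L J) o\<^sub>L C \<Longrightarrow> C o\<^sub>L S = S o\<^sub>L C"
    using positive_sqrt_exists[of "J o\<^sub>L J" 1] zero_less_one by metis
  have SSx: "S (S x) = J (J x)" for x using SS by (metis blinfun_apply_blinfun_compose)
  have SRx: "S (R x) = x" and RSx: "R (S x) = x" for x
    using SR by (metis blinfun_apply_blinfun_compose blinfun_apply_id_blinfun id_apply)+
  have commS: "C (S x) = S (C x)" if "\<And>x. C (J x) = J (C x)" for C :: "'a \<Rightarrow>\<^sub>L 'a" and x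
  proof -
    have "C o\<^sub>L (J o\<^sub>L J) = (J o\<^sub>L J) o\<^sub>L C" by (intro blinfun_eqI) (simp add: that)
    from comm[OF this] show ?thesis by (metis blinfun_apply_blinfun_compose)
  qed
  have commR: "C (R x) = R (C x)" if "\<And>x. C (J x) = J (C x)" for C :: "'a \<Rightarrow>\<^sub>L 'a" and x
    using commS[of C "R x", OF that] by (metis SRx RSx)
  have JS: "J (S x) = S (J x)" and JR: "J (R x) = R (J x)" for x
    by (simp_all add: commS commR)
  have R: "self_adj R"
    unfolding self_adj_def by (metis SRx self_adjD[OF S(1)])
  have Rpos: "0 \<le> R x \<bullet> x" for x
    using S(2)[of "R x"] by (simp add: SRx inner_commute)
  \<comment> \<open>Since S^2 = J^2, the vectors J (R x) and S (R x) = x have equal norm, so J^2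
    \<ge> I gives the bound.\<close>
  have Rle: "R x \<bullet> R x \<le> x \<bullet> x" for x
    using J1[of "R x"] self_adjD[OF J, of "J (R x)" "R x"] self_adjD[OF S(1), of "S (R x)" "R x"]
    by (simp add: SRx flip: SSx)
  have "R x \<bullet> x \<le> 1 * (x \<bullet> x)" for x
  proof -
    have "R x \<bullet> x \<le> norm (R x) * norm x" by (rule norm_cauchy_schwarz)
    also have "\<dots> \<le> norm x * norm x"
      using Rle[of x] by (intro mult_right_mono) (auto simp: norm_le)
    finally show ?thesis by (simp add: power2_norm_eq_inner flip: power2_eq_square)
  qed
  \<comment> \<open>R^2 \<le> R evaluated at \<open>S x\<close> reads I \<le> S.\<close>
  from positive_inner_square_le[OF R Rpos this, of "S x" for x]
  have S1: "x \<bullet> x \<le> S x \<bullet> x" for x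
    by (simp add: RSx inner_commute)
  define V where "V = J o\<^sub>L R"
  have Vx: "V x = J (R x)" for x by (simp add: V_def)
  show thesis
  proof (rule that[of S V])
    show "self_adj V"
      unfolding V_def by (intro self_adj_compose J R blinfun_eqI) (simp add: JR)
    show "V o\<^sub>L V = id_blinfun"
      by (intro blinfun_eqI) (simp add: Vx JR flip: SSx, simp add: RSx flip: JR SSx)
    show "J o\<^sub>L V = S" "V o\<^sub>L J = S"
      by (rule blinfun_eqI, simp add: Vx SRx flip: JR SSx)+
    show "S o\<^sub>L V = J" "V o\<^sub>L S = J"
      by (rule blinfun_eqI, simp add: Vx SRx RSx flip: JS)+
    show "C o\<^sub>L S = S o\<^sub>L C \<and> C o\<^sub>L V = V o\<^sub>L C" if "C o\<^sub>L J = J o\<^sub>L C" for C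
    proof -
      have *: "C (J x) = J (C x)" for x using that by (metis blinfun_apply_blinfun_compose)
      from commS[OF this] commR[OF this] show ?thesis
        by (auto intro!: blinfun_eqI simp: Vx *)
    qed
  qed (rule S S1)+
qed

subsection \<open>Complex Hilbert spaces\<close>

lemma cinner_scaleC_right: "cinner x (c *\<^sub>C y) = cnj c * cinner x y"
  by (metis cinner_commute cinner_scaleC_left complex_cnj_mult)

lemma cinner_zero_left: "cinner 0 x = 0" and cinner_zero_right: "cinner x 0 = 0"
  using cinner_add_left[of 0 0 x] cinner_commute[of x 0] by auto

lemma cinner_diff_left: "cinner (x - y) z = cinner x z - cinner y z"
  using cinner_add_left[of "x - y" y z] by simp

lemma cinner_diff_right: "cinner x (y - z) = cinner x y - cinner x z"
  by (metis cinner_commute cinner_diff_left complex_cnj_diff)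

lemma cinner_eq_zero_commute: "cinner x y = 0 \<longleftrightarrow> cinner y x = 0"
  by (metis cinner_commute complex_cnj_zero)

lemma Im_cinner: "Im (cinner x y) = - ((\<i> *\<^sub>C x) \<bullet> y)"
  by (simp add: inner_eq_Re_cinner cinner_scaleC_left)

lemma inner_scaleC_ii: "(\<i> *\<^sub>C x) \<bullet> y = - (x \<bullet> (\<i> *\<^sub>C y))"
  by (simp add: inner_eq_Re_cinner cinner_scaleC_left cinner_scaleC_right)

lemma scaleC_ii_ii: "\<i> *\<^sub>C \<i> *\<^sub>C x = - x"
  using scaleC_of_real[of "-1" x] by (simp add: scaleC_scaleC)

lemma scaleC_decompose: "c *\<^sub>C x = Re c *\<^sub>R x + Im c *\<^sub>R (\<i> *\<^sub>C x)"
proof -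
  have "c = complex_of_real (Re c) + complex_of_real (Im c) * \<i>"
    by (simp add: complex_eq_iff)
  then have "c *\<^sub>C x = (complex_of_real (Re c) + complex_of_real (Im c) * \<i>) *\<^sub>C x"
    by simp
  then show ?thesis
    by (simp add: scaleC_add_left flip: scaleC_scaleC scaleC_of_real)
qed

lemma scaleC_zero_right: "c *\<^sub>C (0::'a::complex_hilbert) = 0"
  using scaleC_add_right[of c "0::'a" 0] by simp

lemma scaleC_diff_right: "c *\<^sub>C (x - y) = c *\<^sub>C x - c *\<^sub>C y"
  using scaleC_add_right[of c "x - y" y] by simp

lemma scaleC_ii_scaleR: "\<i> *\<^sub>C (r *\<^sub>R x) = r *\<^sub>R (\<i> *\<^sub>C x)"
  by (simp add: scaleC_scaleC mult.commute flip: scaleC_of_real)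

lemma norm_scaleC_ii: "norm (\<i> *\<^sub>C x) = norm x"
  by (simp add: norm_eq inner_scaleC_ii scaleC_ii_ii)

lemma complex_linearI: "(\<And>x. T (\<i> *\<^sub>C x) = \<i> *\<^sub>C T x) \<Longrightarrow> complex_linear T"
  for T :: "'a::complex_hilbert \<Rightarrow>\<^sub>L 'a"
  unfolding complex_linear_def
  by (intro allI, subst (1 2) scaleC_decompose) (simp add: blinfun.bilinear_simps)

lemma complex_linearD: "complex_linear T \<Longrightarrow> T (c *\<^sub>C x) = c *\<^sub>C T x"
  by (simp add: complex_linear_def)

lemma complex_linear_id: "complex_linear id_blinfun"
  by (simp add: complex_linear_def)

lemma complex_linear_add: "complex_linear S \<Longrightarrow> complex_linear T \<Longrightarrow> complex_linear (S + T)"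
  by (simp add: complex_linear_def blinfun.bilinear_simps scaleC_add_right)

lemma complex_linear_diff: "complex_linear S \<Longrightarrow> complex_linear T \<Longrightarrow> complex_linear (S - T)"
  by (simp add: complex_linear_def blinfun.bilinear_simps scaleC_diff_right)

lemma complex_linear_scaleR: "complex_linear T \<Longrightarrow> complex_linear (r *\<^sub>R T)"
  by (intro complex_linearI) (simp add: complex_linearD blinfun.bilinear_simps scaleC_ii_scaleR)

text \<open>Multiplication by \<open>\<i>\<close> is itself a bounded real-linear operator commuting
  with \<open>J\<close>, so it is an admissible \<open>C\<close>.\<close>

lemma complex_linear_if_commutes_ii:
  fixes J :: "'a::complex_hilbert \<Rightarrow>\<^sub>L 'a"
  assumes J: "complex_linear J" and T: "\<And>C. C o\<^sub>L J = J o\<^sub>L C \<Longrightarrow> C o\<^sub>L T = T o\<^sub>L C"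
  shows "complex_linear T"
proof -
  have "bounded_linear (\<lambda>x::'a. \<i> *\<^sub>C x)"
    by (rule bounded_linear_intro[where K = 1])
      (simp_all add: scaleC_add_right scaleC_ii_scaleR norm_scaleC_ii)
  then obtain C :: "'a \<Rightarrow>\<^sub>L 'a" where C: "C x = \<i> *\<^sub>C x" for x
    by (metis bounded_linear_Blinfun_apply)
  have "C o\<^sub>L J = J o\<^sub>L C"
    by (intro blinfun_eqI) (simp add: C complex_linearD[OF J])
  from T[OF this] show ?thesis
    by (intro complex_linearI) (metis C blinfun_apply_blinfun_compose)
qed

section \<open>Adjoints, positivity and absolute values\<close>

lemma adj_eqI:
  fixes S T :: "'a::complex_hilbert \<Rightarrow>\<^sub>L 'a"
  assumes T: "complex_linear T" and S: "\<And>x y. T x \<bullet> y = x \<bullet> S y"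
  shows "adj T = S"
  unfolding adj_def
proof (rule the_equality)
  \<comment> \<open>The imaginary parts are, up to sign, the real identity at
    \<open>\<i> *\<^sub>C x\<close>, so the real adjoint is already the complex one.\<close>
  show "\<forall>x y. cinner (T x) y = cinner x (S y)"
    by (simp add: complex_eq_iff Im_cinner S complex_linearD[OF T, symmetric] flip: inner_eq_Re_cinner)
  show "U = S" if U: "\<forall>x y. cinner (T x) y = cinner x (U y)" for U :: "'a \<Rightarrow>\<^sub>L 'a"
  proof (rule blinfun_eqI)
    fix y
    have "x \<bullet> U y = x \<bullet> S y" for x
      using U S[of x y] by (simp add: inner_eq_Re_cinner)
    then show "U y = S y" by (metis vector_eq_ldot)
  qed
qed

lemma adj_inner:
  assumes T: "complex_linear T"
  shows "T x \<bullet> y = x \<bullet> adj T y"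
  using blinfun_adjoint_exists[of T] adj_eqI[OF T] by metis

lemma adj_cinner:
  assumes T: "complex_linear T"
  shows "cinner (T x) y = cinner x (adj T y)"
  by (simp add: complex_eq_iff Im_cinner adj_inner[OF T] complex_linearD[OF T, symmetric]
      flip: inner_eq_Re_cinner)

lemma complex_linear_adj:
  assumes T: "complex_linear T"
  shows "complex_linear (adj T)"
proof (rule complex_linearI)
  fix y
  have "x \<bullet> adj T (\<i> *\<^sub>C y) = x \<bullet> (\<i> *\<^sub>C adj T y)" for x
    using inner_scaleC_ii[of "T x" y] inner_scaleC_ii[of x "adj T y"]
    by (simp add: adj_inner[OF T, symmetric] complex_linearD[OF T, symmetric])
  then show "adj T (\<i> *\<^sub>C y) = \<i> *\<^sub>C adj T y" by (metis vector_eq_ldot)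
qed

lemma adj_self_adj: "complex_linear T \<Longrightarrow> self_adj T \<Longrightarrow> adj T = T"
  by (intro adj_eqI) (auto simp: self_adj_def)

text \<open>Reduces complex positivity to the real notion used for square roots. Self-adjointness is
  automatic because the quadratic form is real on a complex space.\<close>

lemma positive_op_iff:
  "positive_op T \<longleftrightarrow> complex_linear T \<and> self_adj T \<and> (\<forall>x. 0 \<le> T x \<bullet> x)"
proof
  assume "positive_op T"
  then have T: "complex_linear T" and pos: "\<And>x. cinner (T x) x \<in> \<real>\<^sub>\<ge>\<^sub>0"
    by (auto simp: positive_op_def)
  have Im: "(\<i> *\<^sub>C T x) \<bullet> x = 0" for x
    using pos[of x] Im_cinner[of "T x" x] by (simp add: complex_nonneg_Reals_iff)
  \<comment> \<open>Polarization: the bilinear form \<open>(\<i> T x) \<bullet> y\<close> is alternating.\<close>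
  have skew: "(\<i> *\<^sub>C T x) \<bullet> y = - ((\<i> *\<^sub>C T y) \<bullet> x)" for x y
    using Im[of "x + y"] Im[of x] Im[of y]
    by (simp add: blinfun.bilinear_simps scaleC_add_right inner_simps)
  have "T x \<bullet> y = x \<bullet> T y" for x y
    using skew[of "\<i> *\<^sub>C x" y]
    by (simp add: complex_linearD[OF T] scaleC_ii_ii inner_scaleC_ii[of x] inner_commute)
  with T pos show "complex_linear T \<and> self_adj T \<and> (\<forall>x. 0 \<le> T x \<bullet> x)"
    by (auto simp: self_adj_def inner_eq_Re_cinner complex_nonneg_Reals_iff)
next
  assume T: "complex_linear T \<and> self_adj T \<and> (\<forall>x. 0 \<le> T x \<bullet> x)"
  have "(\<i> *\<^sub>C T x) \<bullet> x = 0" for x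
    using self_adjD[of T "\<i> *\<^sub>C x" x] T inner_scaleC_ii[of x "T x"] complex_linearD[of T \<i> x]
    by (simp add: inner_commute)
  with T show "positive_op T"
    by (simp add: positive_op_def complex_nonneg_Reals_iff Im_cinner flip: inner_eq_Re_cinner)
qed

lemma abs_op_eqI:
  assumes A: "complex_linear A" "self_adj A" and S: "positive_op S" "S o\<^sub>L S = A o\<^sub>L A"
  shows "abs_op A = S"
  unfolding abs_op_def adj_self_adj[OF A]
proof (rule the_equality)
  show "T = S" if "positive_op T \<and> T o\<^sub>L T = A o\<^sub>L A" for T
    by (rule positive_sqrt_unique) (use that S in \<open>simp_all add: positive_op_iff\<close>)
qed (use S in auto)

section \<open>Complex subspaces and their orthogonal projections\<close>

definition csubspace :: "'a::complex_hilbert set \<Rightarrow> bool" where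
  "csubspace M \<longleftrightarrow> subspace M \<and> (\<forall>c. \<forall>x\<in>M. c *\<^sub>C x \<in> M)"

lemma csubspace_null_space: "complex_linear T \<Longrightarrow> csubspace (null_space T)"
  by (auto simp: csubspace_def null_space_def subspace_def blinfun.bilinear_simps complex_linearD
      scaleC_zero_right)

lemma closed_null_space: "closed (null_space T)"
  unfolding null_space_def by (intro closed_Collect_eq continuous_intros)

text \<open>Real orthogonality to both y and \<open>\<i> *\<^sub>C y\<close> kills the real and
  imaginary parts of \<open>cinner x y\<close>.\<close>

lemma orth_compl_eq:
  assumes M: "csubspace M"
  shows "orth_compl M = {x. \<forall>y\<in>M. x \<bullet> y = 0}"
proof -
  have "cinner x y = 0" if "\<forall>y\<in>M. x \<bullet> y = 0" "y \<in> M" for x y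
  proof -
    have "\<i> *\<^sub>C y \<in> M" using M that(2) by (auto simp: csubspace_def)
    then have "x \<bullet> (\<i> *\<^sub>C y) = 0" "x \<bullet> y = 0" using that by auto
    then show ?thesis
      by (simp add: complex_eq_iff Im_cinner inner_scaleC_ii flip: inner_eq_Re_cinner)
  qed
  then show ?thesis
    unfolding orth_compl_def by (auto simp: inner_eq_Re_cinner)
qed

lemma csubspace_orth_compl: "csubspace (orth_compl M)"
  by (auto simp: csubspace_def orth_compl_def subspace_def cinner_zero_left cinner_add_left
      cinner_scaleC_left simp flip: scaleC_of_real)

lemma closed_orth_compl:
  assumes M: "csubspace M"
  shows "closed (orth_compl M)"
  unfolding orth_compl_eq[OF M] Ball_def
  by (intro closed_Collect_all closed_Collect_imp open_Collect_const closed_Collect_eq continuous_intros)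

lemma csubspace_range:
  assumes T: "complex_linear T"
  shows "csubspace (range T)"
proof -
  have "subspace (range T)"
    using linear_subspace_image[OF bounded_linear.linear[OF blinfun.bounded_linear_right] subspace_UNIV] .
  moreover have "c *\<^sub>C T x \<in> range T" for c x
    using complex_linearD[OF T, of c x] by (metis rangeI)
  ultimately show ?thesis by (auto simp: csubspace_def)
qed

lemma csubspace_closure:
  assumes M: "csubspace M"
  shows "csubspace (closure M)"
proof -
  have sub: "subspace (closure M)"
  proof (unfold subspace_def, intro conjI ballI allI)
    show "0 \<in> closure M"
      using M closure_subset subspace_0 by (auto simp: csubspace_def)
    show "x + y \<in> closure M" if xy: "x \<in> closure M" "y \<in> closure M" for x y
    proof -
      obtain X Y where "\<forall>n. X n \<in> M" "X \<longlonglongrightarrow> x" "\<forall>n. Y n \<in> M" "Y \<longlonglongrightarrow> y"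
        using xy unfolding closure_sequential by blast
      moreover from calculation have "(\<lambda>n. X n + Y n) \<longlonglongrightarrow> x + y"
        by (intro tendsto_add)
      ultimately show ?thesis
        using M unfolding closure_sequential csubspace_def
        by (intro exI[of _ "\<lambda>n. X n + Y n"]) (auto intro: subspace_add)
    qed
    show "c *\<^sub>R x \<in> closure M" if "x \<in> closure M" for c x
    proof -
      have "(\<lambda>x. c *\<^sub>R x) ` closure M \<subseteq> closure M"
        using M
        by (intro image_closure_subset continuous_intros)
          (auto simp: csubspace_def intro!: subsetD[OF closure_subset] subspace_scale)
      with that show ?thesis by blast
    qed
  qed
  have "continuous_on UNIV (\<lambda>x::'a. \<i> *\<^sub>C x)"
  proof -
    have "dist (\<i> *\<^sub>C x) (\<i> *\<^sub>C y) = dist x (y::'a)" for x y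
      by (simp add: dist_norm norm_scaleC_ii flip: scaleC_diff_right)
    then show ?thesis by (auto simp: continuous_on_iff)
  qed
  then have "(\<lambda>x. \<i> *\<^sub>C x) ` closure M \<subseteq> closure M"
    using M closure_subset
    by (intro image_closure_subset) (auto intro: continuous_on_subset simp: csubspace_def)
  then have ii: "\<i> *\<^sub>C x \<in> closure M" if "x \<in> closure M" for x
    using that by blast
  have "c *\<^sub>C x \<in> closure M" if "x \<in> closure M" for c x
    unfolding scaleC_decompose[of c x] using sub that ii by (intro subspace_add subspace_scale)
  with sub show ?thesis by (simp add: csubspace_def)
qed

text \<open>The difference of two candidates lies in \<open>M\<close> and is orthogonal to
  \<open>M\<close>, hence vanishes.\<close>

lemma proj_eqI:
  fixes Q :: "'a::complex_hilbert \<Rightarrow>\<^sub>L 'a"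
  assumes M: "csubspace M" and Q: "\<And>x. Q x \<in> M" "\<And>x y. y \<in> M \<Longrightarrow> (x - Q x) \<bullet> y = 0"
  shows "proj M = Q"
  unfolding proj_def orth_compl_eq[OF M]
proof (rule the_equality)
  show "U = Q" if U: "\<forall>x. U x \<in> M \<and> x - U x \<in> {x. \<forall>y\<in>M. x \<bullet> y = 0}" for U :: "'a \<Rightarrow>\<^sub>L 'a"
  proof (rule blinfun_eqI)
    fix x
    have d: "U x - Q x \<in> M"
      using M U Q by (auto simp: csubspace_def intro: subspace_diff)
    have "(U x - Q x) \<bullet> (U x - Q x) = (x - Q x) \<bullet> (U x - Q x) - (x - U x) \<bullet> (U x - Q x)"
      by (simp add: inner_simps)
    also have "\<dots> = 0" using d Q(2) U by simp
    finally show "U x = Q x" by simp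
  qed
qed (use Q in auto)

lemma proj_properties:
  assumes M: "csubspace M" "closed M"
  shows "proj M x \<in> M" and "y \<in> M \<Longrightarrow> (x - proj M x) \<bullet> y = 0"
    and "x - proj M x \<in> orth_compl M"
proof -
  obtain Q :: "'a \<Rightarrow>\<^sub>L 'a" where Q: "\<forall>x. Q x \<in> M \<and> (\<forall>m\<in>M. (x - Q x) \<bullet> m = 0)"
    using blinfun_orthogonal_projection_exists[of M] M unfolding csubspace_def by blast
  then have "proj M = Q" by (intro proj_eqI M) auto
  with Q show "proj M x \<in> M" "y \<in> M \<Longrightarrow> (x - proj M x) \<bullet> y = 0"
    "x - proj M x \<in> orth_compl M"
    by (auto simp: orth_compl_eq[OF M(1)])
qed

text \<open>For self-adjoint \<open>T\<close> the closure of the range is the orthogonal complement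
  of the null space, so range projections can be computed from null spaces.\<close>

lemma range_proj_self_adj:
  assumes T: "complex_linear T" "self_adj T"
  shows "range_proj T = id_blinfun - proj (null_space T)"
  unfolding range_proj_def
proof (rule proj_eqI)
  let ?C = "closure (range T)"
  show C: "csubspace ?C" by (intro csubspace_closure csubspace_range T)
  note N = proj_properties[OF csubspace_null_space[OF T(1)] closed_null_space]
  have orth: "z \<bullet> y = 0" if z: "z \<in> null_space T" and y: "y \<in> ?C" for z y
  proof -
    have "closed {y. z \<bullet> y = 0}"
      by (intro closed_Collect_eq continuous_intros)
    moreover have "range T \<subseteq> {y. z \<bullet> y = 0}"
      using z self_adjD[OF T(2), of z] by (auto simp: null_space_def)
    ultimately show ?thesis using y closure_minimal by blast
  qed
  show "(x - (id_blinfun - proj (null_space T)) x) \<bullet> y = 0" if "y \<in> ?C" for x y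
    using orth[OF N(1) that] by (simp add: blinfun.bilinear_simps)
  fix x
  define z where "z = x - proj (null_space T) x"
  \<comment> \<open>The part of \<open>z\<close> outside the closed range. It is orthogonal to the
    range, hence in the null space, to which both \<open>z\<close> and the closed range are
    orthogonal; so it is 0.\<close>
  define d where "d = z - proj ?C z"
  note PC = proj_properties[OF C closed_closure]
  have "T d \<bullet> y = 0" for y
    using PC(2)[of "T y" z] closure_subset[of "range T"] by (auto simp: self_adjD[OF T(2)] d_def)
  then have d: "d \<in> null_space T"
    using inner_eq_zero_iff[of "T d"] by (simp add: null_space_def)
  have "d \<bullet> d = z \<bullet> d - d \<bullet> proj ?C z"
    by (simp add: d_def inner_simps inner_commute)
  also have "\<dots> = 0"
    using N(2)[OF d, of x] orth[OF d PC(1)] by (simp add: z_def)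
  finally have "proj ?C z = z" by (simp add: d_def)
  then have "z \<in> ?C" using PC(1)[of z] by simp
  then show "(id_blinfun - proj (null_space T)) x \<in> ?C"
    by (simp add: blinfun.bilinear_simps z_def)
qed

subsection \<open>Idempotents\<close>

lemma adj_id_minus: "complex_linear P \<Longrightarrow> adj (id_blinfun - P) = id_blinfun - adj P"
  by (intro adj_eqI complex_linear_diff complex_linear_id)
    (simp_all add: blinfun.bilinear_simps inner_simps adj_inner)

text \<open>The square of P + adj P - I exceeds I by the positive operator of the form x \<mapsto>
  norm (P x - adj P x)^2; idempotency enters through the cross term.\<close>

lemma idempotent_symmetry_expanding:
  assumes P: "complex_linear P" and idem: "P o\<^sub>L P = P"
  shows "x \<bullet> x \<le> (P + adj P - id_blinfun) x \<bullet> (P + adj P - id_blinfun) x"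
proof -
  have PP: "P (P x) = P x" for x using idem by (metis blinfun_apply_blinfun_compose)
  have 1: "P x \<bullet> adj P x = P x \<bullet> x" and 2: "adj P x \<bullet> x = P x \<bullet> x"
    using adj_inner[OF P, of "P x" x] adj_inner[OF P, of x x] by (simp_all add: PP inner_commute)
  have "(P + adj P - id_blinfun) x \<bullet> (P + adj P - id_blinfun) x
      = x \<bullet> x + (P x - adj P x) \<bullet> (P x - adj P x)"
    using 1 2 by (simp add: blinfun.bilinear_simps inner_simps inner_commute)
  then show ?thesis by simp
qed

text \<open>With N the projection onto the null space of J + I, the two range projections come out
  as I - E and I - (E + N), so they differ by N.\<close>

lemma idempotent_range_proj_pos_part:
  fixes P :: "'a::complex_hilbert \<Rightarrow>\<^sub>L 'a"
  assumes P: "complex_linear P" and idem: "P o\<^sub>L P = P"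
  shows "range_proj (pos_part (2 *\<^sub>R id_blinfun - P - adj P)) =
        range_proj (neg_part (P + adj P)) + proj (null_space (P + adj P))"
proof -
  define J where "J = P + adj P - id_blinfun"
  have Jc: "complex_linear J"
    unfolding J_def by (intro complex_linear_diff complex_linear_add complex_linear_id
        complex_linear_adj P)
  have J: "self_adj J"
    unfolding self_adj_def J_def using adj_inner[OF P]
    by (simp add: blinfun.bilinear_simps inner_simps inner_commute)
  have J1: "x \<bullet> x \<le> J x \<bullet> J x" for x
    unfolding J_def by (rule idempotent_symmetry_expanding[OF P idem])
  obtain S V where S: "self_adj S" "\<And>x. x \<bullet> x \<le> S x \<bullet> x"
    and V: "self_adj V" "V o\<^sub>L V = id_blinfun"
    and c: "J o\<^sub>L V = S" "V o\<^sub>L J = S" "S o\<^sub>L V = J" "V o\<^sub>L S = J"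
    and comm: "\<And>C. C o\<^sub>L J = J o\<^sub>L C \<Longrightarrow> C o\<^sub>L S = S o\<^sub>L C \<and> C o\<^sub>L V = V o\<^sub>L C"
    by (rule sign_decomposition[OF J J1]) (rule that; assumption)
  have Sc: "complex_linear S" and Vc: "complex_linear V"
    by (rule complex_linear_if_commutes_ii[OF Jc], simp add: comm)+
  have JV: "J (V x) = S x" and VJ: "V (J x) = S x" and SV: "S (V x) = J x"
    and VS: "V (S x) = J x" and VV: "V (V x) = x" for x
    using arg_cong[OF c(1), of "\<lambda>T. T x"] arg_cong[OF c(2), of "\<lambda>T. T x"]
      arg_cong[OF c(3), of "\<lambda>T. T x"] arg_cong[OF c(4), of "\<lambda>T. T x"]
      arg_cong[OF V(2), of "\<lambda>T. T x"] by simp_all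
  have SS: "S (S x) = J (J x)" and SJ: "S (J x) = J (S x)" for x
    using JV[of "S x"] SV[of "S x"] by (simp_all add: VS)
  have A: "P + adj P = J + id_blinfun" and B: "2 *\<^sub>R id_blinfun - P - adj P = id_blinfun - J"
    by (simp_all add: J_def scaleR_2)
  have Ac: "complex_linear (J + id_blinfun)" and As: "self_adj (J + id_blinfun)"
    and Bc: "complex_linear (id_blinfun - J)" and Bs: "self_adj (id_blinfun - J)"
    by (intro complex_linear_add complex_linear_diff complex_linear_id self_adj_add self_adj_diff
        self_adj_id J Jc)+
  have Vle: "\<bar>V x \<bullet> x\<bar> \<le> x \<bullet> x" for x
  proof -
    have "norm (V x) = norm x"
      using self_adjD[OF V(1), of "V x" x] by (simp add: norm_eq VV)
    then show ?thesis
      using Cauchy_Schwarz_ineq2[of "V x" x] by (simp add: power2_norm_eq_inner flip: power2_eq_square)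
  qed
  have "0 \<le> (S + V) x \<bullet> x" "0 \<le> (S - V) x \<bullet> x" for x
    using S(2)[of x] Vle[of x] by (simp_all add: blinfun.bilinear_simps inner_simps)
  then have pos: "positive_op (S + V)" "positive_op (S - V)"
    by (simp_all add: positive_op_iff complex_linear_add complex_linear_diff self_adj_add
        self_adj_diff S V Sc Vc)
  \<comment> \<open>The squares agree because S V = V S = J, S^2 = J^2 and V^2 = I.\<close>
  have absA: "abs_op (J + id_blinfun) = S + V"
    by (rule abs_op_eqI[OF Ac As pos(1)], rule blinfun_eqI)
      (simp add: blinfun.bilinear_simps JV VJ SV VS VV SS SJ)
  have absB: "abs_op (id_blinfun - J) = S - V"
    by (rule abs_op_eqI[OF Bc Bs pos(2)], rule blinfun_eqI)
      (simp add: blinfun.bilinear_simps JV VJ SV VS VV SS SJ)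
  let ?Ap = "neg_part (J + id_blinfun)" and ?Bp = "pos_part (id_blinfun - J)"
  have Apx: "?Ap x = (1/2) *\<^sub>R (S x + V x - J x - x)"
    and Bpx: "?Bp x = (1/2) *\<^sub>R (S x - V x - J x + x)" for x
    unfolding neg_part_def pos_part_def absA absB
    by (simp_all add: blinfun.bilinear_simps algebra_simps)
  have Apc: "complex_linear ?Ap" "self_adj ?Ap" and Bpc: "complex_linear ?Bp" "self_adj ?Bp"
    unfolding neg_part_def pos_part_def absA absB
    by (intro complex_linear_add complex_linear_diff complex_linear_scaleR complex_linear_id
        self_adj_add self_adj_diff self_adj_id self_adj_scaleR J Jc S Sc V Vc)+
  have S1: "x = 0" if "S x + x = 0" for x
  proof -
    have "S x \<bullet> x + x \<bullet> x = 0" using that by (simp flip: inner_add_left)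
    then have "x \<bullet> x \<le> 0" using S(2)[of x] inner_ge_zero[of x] by linarith
    then show ?thesis by (metis inner_eq_zero_iff inner_ge_zero order_antisym)
  qed
  define E where "E = (1/2) *\<^sub>R (id_blinfun + V)"
  have Ex: "E x = (1/2) *\<^sub>R (x + V x)" for x by (simp add: E_def blinfun.bilinear_simps)
  have Bnull: "V x = x" if "x \<in> null_space ?Bp" for x
  proof -
    have "S x - V x - J x + x = 0" using that by (simp add: null_space_def Bpx)
    \<comment> \<open>Substituting J = S V factors the equation through S + I, which is injective by
      \<open>S1\<close>.\<close>
    then have "S (x - V x) + (x - V x) = 0"
      by (simp add: blinfun.bilinear_simps SV algebra_simps)
    from S1[OF this] show ?thesis by simp
  qed
  have projB: "proj (null_space ?Bp) = E"
  proof (rule proj_eqI[OF csubspace_null_space[OF Bpc(1)]])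
    show "E x \<in> null_space ?Bp" for x
      unfolding null_space_def mem_Collect_eq Bpx Ex
      by (simp add: blinfun.bilinear_simps SV VV JV algebra_simps)
    show "(x - E x) \<bullet> y = 0" if "y \<in> null_space ?Bp" for x y
      using self_adjD[OF V(1), of x y] Bnull[OF that] by (simp add: Ex inner_simps)
  qed
  let ?N = "proj (null_space (J + id_blinfun))"
  note N = proj_properties[OF csubspace_null_space[OF Ac] closed_null_space]
  have Anull: "V z = - z" "S z + V z = 0" if "z \<in> null_space (J + id_blinfun)" for z
  proof -
    have z: "J z + z = 0" using that by (simp add: null_space_def blinfun.bilinear_simps)
    \<comment> \<open>Applying \<open>V\<close> to J z = - z gives S z = - V z; adding the two
      equations puts z + V z in the kernel of S + I.\<close>
    have "V (J z + z) = 0" by (simp add: z)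
    then show Sz: "S z + V z = 0" by (simp add: blinfun.bilinear_simps VJ)
    have "S (z + V z) + (z + V z) = (S z + V z) + (J z + z)"
      by (simp add: blinfun.bilinear_simps SV)
    then have "S (z + V z) + (z + V z) = 0" by (simp only: Sz z add_0)
    from S1[OF this]
    show "V z = - z" by (simp add: eq_neg_iff_add_eq_0 add.commute)
  qed
  have projA: "proj (null_space ?Ap) = E + ?N"
  proof (rule proj_eqI[OF csubspace_null_space[OF Apc(1)]])
    fix x
    define z where "z = ?N x"
    have z: "z \<in> null_space (J + id_blinfun)" using N(1) by (simp add: z_def)
    have "J z + z = 0" using z by (simp add: null_space_def blinfun.bilinear_simps)
    with Anull(2)[OF z] have "?Ap z = 0" by (simp only: Apx diff_diff_eq) simp
    moreover have "?Ap (E x) = 0"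
      unfolding Apx Ex by (simp add: blinfun.bilinear_simps SV VV JV algebra_simps)
    ultimately show "(E + ?N) x \<in> null_space ?Ap"
      by (simp add: null_space_def blinfun.bilinear_simps z_def)
    fix y assume "y \<in> null_space ?Ap"
    then have "S y + V y - J y - y = 0" by (simp add: null_space_def Apx)
    \<comment> \<open>Since J V = S, applying J + I to y - V y gives minus the left-hand side
      above.\<close>
    then have "y - V y \<in> null_space (J + id_blinfun)"
      by (simp add: null_space_def blinfun.bilinear_simps JV algebra_simps)
    from N(2)[OF this, of x] have "(x - z) \<bullet> (y - V y) = 0" by (simp add: z_def)
    moreover have "z \<bullet> V y = - (z \<bullet> y)" "x \<bullet> V y = V x \<bullet> y"
      using self_adjD[OF V(1), of z y] self_adjD[OF V(1), of x y] Anull(1)[OF z] by simp_all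
    ultimately show "(x - (E + ?N) x) \<bullet> y = 0"
      unfolding blinfun.add_left z_def[symmetric] Ex by (simp add: inner_simps field_simps)
  qed
  show ?thesis
    unfolding A B range_proj_self_adj[OF Apc] range_proj_self_adj[OF Bpc] projA projB
    by simp
qed

text \<open>Both sides are the part of R(P) orthogonal to R(I - P). Only the corner values of
  \<open>P1\<close> and \<open>Q1\<close> are assumed, so the lemma also applies to I - P with their
  roles exchanged.\<close>

lemma idempotent_null_space_adj_on:
  fixes P :: "'a::complex_hilbert \<Rightarrow>\<^sub>L 'a"
  assumes P: "complex_linear P" and idem: "P o\<^sub>L P = P"
    and P1: "\<And>v. v \<in> orth_compl (range P) \<Longrightarrow> P1 v = P v"
    and Q1: "\<And>v. v \<in> orth_compl (range (id_blinfun - P)) \<Longrightarrow> Q1 v = (id_blinfun - P) v"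
  shows "null_space_on (range P) (adj_on (orth_compl (range P)) P1) =
    null_space_on (orth_compl (range (id_blinfun - P))) Q1"
proof -
  have PP: "P (P x) = P x" for x using idem by (metis blinfun_apply_blinfun_compose)
  have ran: "z \<in> range P \<longleftrightarrow> P z = z" for z by (metis PP rangeE rangeI)
  have "range P = null_space (id_blinfun - P)"
    using ran by (auto simp: null_space_def blinfun.bilinear_simps PP)
  then have closed: "closed (range P)" by (simp add: closed_null_space)
  let ?K = "orth_compl (range P)"
  note K = csubspace_orth_compl[of "range P"] closed_orth_compl[OF csubspace_range[OF P]]
  have K0: "0 \<in> ?K" by (simp add: orth_compl_def cinner_zero_left)
  have Kz: "cinner z k = 0" "cinner k z = 0" if "z \<in> range P" "k \<in> ?K" for z k
    using that cinner_eq_zero_commute[of z k] by (auto simp: orth_compl_def)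
  have adj0: "adj_on ?K P1 z = 0 \<longleftrightarrow> (\<forall>x\<in>?K. cinner (P x) z = 0)" for z
  proof -
    let ?p = "\<lambda>w. w \<in> ?K \<and> (\<forall>x\<in>?K. cinner (P1 x) z = cinner x w)"
    have uniq: "w = w'" if w: "?p w" and w': "?p w'" for w w'
    proof -
      have "w - w' \<in> ?K"
        using K(1) w w' by (auto simp: csubspace_def intro: subspace_diff)
      then have "cinner (w - w') w = cinner (w - w') w'" using w w' by metis
      then have "cinner (w - w') (w - w') = 0" by (simp add: cinner_diff_right)
      then have "(w - w') \<bullet> (w - w') = 0" by (simp add: inner_eq_Re_cinner)
      then show ?thesis by simp
    qed
    \<comment> \<open>The adjoint of the corner is the full adjoint followed by projection back to
      \<open>?K\<close>. With \<open>uniq\<close> this justifies the definite description in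
      \<open>adj_on\<close>.\<close>
    have ex: "?p (proj ?K (adj P z))"
    proof (intro conjI ballI)
      show "proj ?K (adj P z) \<in> ?K" using proj_properties(1)[OF K] .
      fix x assume x: "x \<in> ?K"
      have "cinner (adj P z - proj ?K (adj P z)) x = 0"
        using proj_properties(3)[OF K, of "adj P z"] x unfolding orth_compl_def[of ?K] by blast
      then have "cinner x (adj P z - proj ?K (adj P z)) = 0"
        by (simp add: cinner_eq_zero_commute)
      then show "cinner (P1 x) z = cinner x (proj ?K (adj P z))"
        by (simp add: P1[OF x] adj_cinner[OF P] cinner_diff_right)
    qed
    show ?thesis
    proof
      assume "adj_on ?K P1 z = 0"
      moreover have "?p (adj_on ?K P1 z)"
        unfolding adj_on_def by (rule theI[of ?p, OF ex uniq[OF _ ex]])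
      ultimately show "\<forall>x\<in>?K. cinner (P x) z = 0"
        by (metis P1 cinner_zero_right)
    next
      assume "\<forall>x\<in>?K. cinner (P x) z = 0"
      then have p0: "?p 0" using K0 by (simp add: P1 cinner_zero_right)
      show "adj_on ?K P1 z = 0"
        unfolding adj_on_def by (rule the_equality[of ?p, OF p0 uniq[OF _ p0]])
    qed
  qed
  have key: "(\<forall>x\<in>?K. cinner (P x) z = 0) \<longleftrightarrow> z \<in> orth_compl (range (id_blinfun - P))"
    if z: "z \<in> range P" for z
  proof
    assume *: "\<forall>x\<in>?K. cinner (P x) z = 0"
    have "cinner z (y - P y) = 0" for y
    proof -
      \<comment> \<open>\<open>y\<close> and \<open>k\<close> differ by a vector of R(P), which I -
        P annihilates, so testing against I - P only needs vectors of \<open>?K\<close>.\<close>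
      define k where "k = y - proj (range P) y"
      have k: "k \<in> ?K" and m: "proj (range P) y \<in> range P"
        using proj_properties[OF csubspace_range[OF P] closed] by (auto simp: k_def)
      have "y - P y = k - P k"
        using m by (simp add: k_def blinfun.bilinear_simps ran)
      moreover have "cinner z (P k) = 0"
        using * k cinner_eq_zero_commute by blast
      ultimately show ?thesis
        using Kz(1)[OF z k] by (simp add: cinner_diff_right)
    qed
    then show "z \<in> orth_compl (range (id_blinfun - P))"
      by (auto simp: orth_compl_def blinfun.bilinear_simps)
  next
    assume "z \<in> orth_compl (range (id_blinfun - P))"
    then have *: "cinner z (x - P x) = 0" for x
      by (auto simp: orth_compl_def blinfun.bilinear_simps)
    show "\<forall>x\<in>?K. cinner (P x) z = 0"
    proof
      fix x assume "x \<in> ?K"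
      with *[of x] Kz(1)[OF z] have "cinner z (P x) = 0" by (simp add: cinner_diff_right)
      then show "cinner (P x) z = 0" by (simp add: cinner_eq_zero_commute)
    qed
  qed
  have "Q1 z = 0 \<longleftrightarrow> z \<in> range P" if "z \<in> orth_compl (range (id_blinfun - P))" for z
    unfolding ran Q1[OF that] by (auto simp: blinfun.bilinear_simps)
  then show ?thesis
    unfolding null_space_on_def adj0 using key by blast
qed

text \<open>The matrix identity at \<open>u = 0\<close>.\<close>

lemma has_op_matrix_corner:
  assumes m: "has_op_matrix T (range T) (\<lambda>u. u) B (\<lambda>_. 0) (\<lambda>_. 0)" and v: "v \<in> orth_compl (range T)"
  shows "B v = T v"
proof -
  have "0 \<in> range T" by (metis blinfun.zero_right rangeI)
  then have "T (0 + v) = (0 + B v) + (0 + 0)"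
    using m v unfolding has_op_matrix_def by blast
  then show ?thesis by simp
qed

theorem theorem12:
  fixes P :: "'a::complex_hilbert \<Rightarrow>\<^sub>L 'a" and P1 Q1 :: "'a \<Rightarrow> 'a"
  assumes separable: "separable_space (euclidean :: 'a topology)"
    and clin: "complex_linear P"
    and idem: "P o\<^sub>L P = P"
    and matrix_P: "has_op_matrix P (range P) (\<lambda>u. u) P1 (\<lambda>_. 0) (\<lambda>_. 0)"
    and matrix_I_P:
      "has_op_matrix (id_blinfun - P) (range (id_blinfun - P)) (\<lambda>u. u) Q1 (\<lambda>_. 0) (\<lambda>_. 0)"
  shows
    "(range_proj (pos_part (2 *\<^sub>R id_blinfun - P - adj P)) =
        range_proj (neg_part (P + adj P)) + proj (null_space (P + adj P))) \<and>
     (proj (null_space_on (range P) (adj_on (orth_compl (range P)) P1)) =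
        proj (null_space_on (orth_compl (range (id_blinfun - P))) Q1) \<and>
      proj (null_space_on (orth_compl (range P)) P1) =
        proj (null_space_on (range (id_blinfun - P))
          (adj_on (orth_compl (range (id_blinfun - P))) Q1))) \<and>
     (range_proj (neg_part (2 *\<^sub>R id_blinfun - P - adj P)) +
        proj (null_space (2 *\<^sub>R id_blinfun - P - adj P)) =
      range_proj (pos_part (P + adj P)))"
proof -
  let ?Q = "id_blinfun - P"
  have Q: "complex_linear ?Q" by (intro complex_linear_diff complex_linear_id clin)
  have PP: "P (P x) = P x" for x using idem by (metis blinfun_apply_blinfun_compose)
  have QQ: "?Q o\<^sub>L ?Q = ?Q"
    by (intro blinfun_eqI) (simp add: blinfun.bilinear_simps PP)
  note P1 = has_op_matrix_corner[OF matrix_P] and Q1 = has_op_matrix_corner[OF matrix_I_P]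
  have i: "null_space_on (range P) (adj_on (orth_compl (range P)) P1) =
      null_space_on (orth_compl (range ?Q)) Q1"
    using P1 Q1 by (intro idempotent_null_space_adj_on clin idem)
  have ii: "null_space_on (range ?Q) (adj_on (orth_compl (range ?Q)) Q1) =
      null_space_on (orth_compl (range P)) P1"
    using idempotent_null_space_adj_on[OF Q QQ, of Q1 P1] P1 Q1 by simp
  \<comment> \<open>Passing to I - P exchanges the two operators, so (i) for I - P is (iii) read
    from right to left.\<close>
  have "2 *\<^sub>R id_blinfun - ?Q - adj ?Q = P + adj P" "?Q + adj ?Q = 2 *\<^sub>R id_blinfun - P - adj P"
    by (simp_all add: adj_id_minus[OF clin] scaleR_2)
  with idempotent_range_proj_pos_part[OF Q QQ]
  show ?thesis
    using idempotent_range_proj_pos_part[OF clin idem] i ii by simp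
qed

end
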